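(* Let $ABC$ be a given (nondegenerate) triangle in the two-dimensional Euclidean plane. The locus of all points $P$ of the plane with the property that the projections of $P$ onto the sides of the triangle $ABC$ are three collinear points is the circumcircle of $\Delta ABC$. That is, for a point $P$ of the plane, the orthogonal projections of $P$ onto the lines $BC$, $AC$ and $AB$ are collinear if and only if $P$ lies on the circumcircle of $\Delta ABC$.
   Context: All points lie in a two-dimensional Euclidean plane. The projections onto the sides are the orthogonal projections onto the lines $BC$, $AC$, $AB$ containing the sides. Three points are called collinear if some line contains all of them; some of the points are allowed to coincide (as happens, for instance, when $P$ is a vertex of the triangle). *)

theory Defs
  imports "HOL-Analysis.Analysis"
begin

definition is_orth_proj :: "'a::euclidean_space set \<Rightarrow> 'a \<Rightarrow> 'a \<Rightarrow> bool" where
  "is_orth_proj L P F \<longleftrightarrow> F \<in> L \<and> (\<forall>X\<in>L. \<forall>Y\<in>L. orthogonal (P - F) (Y - X))"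

(* Meaningful only when the foot is unique; see is_orth_proj_line_ex1 for lines. *)
definition orth_proj :: "'a::euclidean_space set \<Rightarrow> 'a \<Rightarrow> 'a" where
  "orth_proj L P = (THE F. is_orth_proj L P F)"

definition circle_through :: "real^2 \<Rightarrow> real^2 \<Rightarrow> real^2 \<Rightarrow> (real^2) set \<Rightarrow> bool" where
  "circle_through A B C K \<longleftrightarrow> (\<exists>Z r. r > 0 \<and> K = sphere Z r) \<and> A \<in> K \<and> B \<in> K \<and> C \<in> K"

(* Meaningful only for noncollinear A, B, C; see circle_through_ex1. *)
definition circumcircle :: "real^2 \<Rightarrow> real^2 \<Rightarrow> real^2 \<Rightarrow> (real^2) set" where
  "circumcircle A B C = (THE K. circle_through A B C K)"

lemma is_orth_proj_unique:
  assumes "is_orth_proj L P F" "is_orth_proj L P G"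
  shows "F = G"
proof -
  have "orthogonal (P - F) (F - G)" "orthogonal (P - G) (F - G)"
    using assms by (auto simp: is_orth_proj_def)
  then have "(F - G) \<bullet> (F - G) = 0"
    by (auto simp: orthogonal_def inner_diff_left)
  then show ?thesis by simp
qed

lemma is_orth_proj_line_ex1:
  fixes B C P :: "'a::euclidean_space"
  assumes "B \<noteq> C"
  shows "\<exists>!F. is_orth_proj (affine hull {B, C}) P F"
proof -
  define t where "t = ((P - B) \<bullet> (C - B)) / ((C - B) \<bullet> (C - B))"
  define F where "F = B + t *\<^sub>R (C - B)"
  have nz: "(C - B) \<bullet> (C - B) \<noteq> 0" using assms by simp
  have line: "affine hull {B, C} = range (\<lambda>u. B + u *\<^sub>R (C - B))"
    by (rule affine_hull_2_alt)
  have "(P - F) \<bullet> (C - B) = (P - B) \<bullet> (C - B) - t * ((C - B) \<bullet> (C - B))"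
    by (simp add: F_def inner_diff_left inner_add_left)
  also have "\<dots> = 0" using nz by (simp add: t_def)
  finally have o: "(P - F) \<bullet> (C - B) = 0" .
  have "orthogonal (P - F) (Y - X)"
    if XY: "X \<in> affine hull {B, C}" "Y \<in> affine hull {B, C}" for X Y
  proof -
    obtain x y where "X = B + x *\<^sub>R (C - B)" "Y = B + y *\<^sub>R (C - B)"
      using XY unfolding line by blast
    then have "Y - X = (y - x) *\<^sub>R (C - B)" by (simp add: scaleR_left_diff_distrib)
    then show ?thesis using o by (simp add: orthogonal_def)
  qed
  moreover have "F \<in> affine hull {B, C}" unfolding line F_def by blast
  ultimately have "is_orth_proj (affine hull {B, C}) P F"
    by (simp add: is_orth_proj_def)
  then show ?thesis using is_orth_proj_unique by blast
qed

lemma is_orth_proj_orth_proj: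
  fixes B C P :: "'a::euclidean_space"
  assumes "B \<noteq> C"
  shows "is_orth_proj (affine hull {B, C}) P (orth_proj (affine hull {B, C}) P)"
  unfolding orth_proj_def by (rule theI'[OF is_orth_proj_line_ex1[OF assms]])

lemma noncollinear_det:
  fixes A B C :: "real^2"
  assumes "\<not> collinear {A, B, C}"
  shows "(B$1 - A$1) * (C$2 - A$2) - (B$2 - A$2) * (C$1 - A$1) \<noteq> 0"
proof
  assume d: "(B$1 - A$1) * (C$2 - A$2) - (B$2 - A$2) * (C$1 - A$1) = 0"
  have "collinear {B, A, C}"
  proof (cases "B = A")
    case False
    then have "B$1 - A$1 \<noteq> 0 \<or> B$2 - A$2 \<noteq> 0" by (auto simp: vec_eq_iff forall_2)
    then have "\<exists>c. C - A = c *\<^sub>R (B - A)"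
    proof
      assume "B$1 - A$1 \<noteq> 0"
      then have "C - A = ((C$1 - A$1) / (B$1 - A$1)) *\<^sub>R (B - A)"
        using d by (simp add: vec_eq_iff forall_2 eq_divide_eq mult.commute)
      then show ?thesis ..
    next
      assume "B$2 - A$2 \<noteq> 0"
      then have "C - A = ((C$2 - A$2) / (B$2 - A$2)) *\<^sub>R (B - A)"
        using d by (simp add: vec_eq_iff forall_2 eq_divide_eq mult.commute)
      then show ?thesis ..
    qed
    then have "collinear {0, B - A, C - A}" by (auto simp: collinear_lemma)
    then show ?thesis by (subst collinear_3) auto
  qed simp
  then show False using assms by (simp add: insert_commute)
qed

lemma dist_eq_iff_2:
  fixes X Y Z :: "real^2"
  shows "dist Z X = dist Z Y \<longleftrightarrow>
    2 * (Y$1 - X$1) * (Z$1 - X$1) + 2 * (Y$2 - X$2) * (Z$2 - X$2)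
      = (Y$1 - X$1)^2 + (Y$2 - X$2)^2"
  by (simp add: dist_norm norm_eq_sqrt_inner inner_vec_def sum_2 power2_eq_square algebra_simps)

lemma circumcenter_ex1:
  fixes A B C :: "real^2"
  assumes "\<not> collinear {A, B, C}"
  shows "\<exists>!Z. dist Z A = dist Z B \<and> dist Z A = dist Z C"
proof -
  define a b c d where abcd: "a = B$1 - A$1" "b = B$2 - A$2" "c = C$1 - A$1" "d = C$2 - A$2"
  have nz: "a * d - b * c \<noteq> 0" using noncollinear_det[OF assms] by (simp add: abcd)
  define p q where pq: "p = (a^2 + b^2) / 2" "q = (c^2 + d^2) / 2"
  have iff: "dist Z A = dist Z B \<and> dist Z A = dist Z C \<longleftrightarrow>
      a * (Z$1 - A$1) + b * (Z$2 - A$2) = p \<and> c * (Z$1 - A$1) + d * (Z$2 - A$2) = q" for Z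
    unfolding dist_eq_iff_2 abcd[symmetric] pq by (auto simp: field_simps)
  define Z :: "real^2" where
    "Z = vector [A$1 + (d * p - b * q) / (a * d - b * c), A$2 + (a * q - c * p) / (a * d - b * c)]"
  have Z12: "Z$1 - A$1 = (d * p - b * q) / (a * d - b * c)"
    "Z$2 - A$2 = (a * q - c * p) / (a * d - b * c)" by (simp_all add: Z_def)
  have "a * (d * p - b * q) + b * (a * q - c * p) = p * (a * d - b * c)"
    "c * (d * p - b * q) + d * (a * q - c * p) = q * (a * d - b * c)"
    by (simp_all add: algebra_simps)
  then have 1: "a * (Z$1 - A$1) + b * (Z$2 - A$2) = p" "c * (Z$1 - A$1) + d * (Z$2 - A$2) = q"
    unfolding Z12 using nz by (simp_all flip: add_divide_distrib)
  have 2: "W = Z" if "a * (W$1 - A$1) + b * (W$2 - A$2) = p"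
    "c * (W$1 - A$1) + d * (W$2 - A$2) = q" for W
  proof -
    have "(a * d - b * c) * (W$1 - A$1) = d * p - b * q"
      "(a * d - b * c) * (W$2 - A$2) = a * q - c * p"
      unfolding that[symmetric] by (simp_all add: algebra_simps)
    then have "W$1 - A$1 = Z$1 - A$1" "W$2 - A$2 = Z$2 - A$2"
      unfolding Z12 using nz by (simp_all add: eq_divide_eq mult.commute)
    then show ?thesis by (simp add: vec_eq_iff forall_2)
  qed
  show ?thesis unfolding iff using 1 2 by blast
qed

lemma circle_through_ex1:
  fixes A B C :: "real^2"
  assumes "\<not> collinear {A, B, C}"
  shows "\<exists>!K. circle_through A B C K"
proof -
  obtain Z where Z: "dist Z A = dist Z B" "dist Z A = dist Z C"
    and u: "\<And>W. dist W A = dist W B \<Longrightarrow> dist W A = dist W C \<Longrightarrow> W = Z"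
    using circumcenter_ex1[OF assms] by metis
  have "dist Z A > 0" using Z assms by auto
  then have "circle_through A B C (sphere Z (dist Z A))"
    unfolding circle_through_def using Z by (metis mem_sphere)
  moreover have "K = sphere Z (dist Z A)" if K: "circle_through A B C K" for K
  proof -
    obtain W r where W: "K = sphere W r" "A \<in> K" "B \<in> K" "C \<in> K"
      using K unfolding circle_through_def by blast
    then have "W = Z" by (intro u) auto
    then show ?thesis using W by auto
  qed
  ultimately show ?thesis by blast
qed

lemma circle_through_circumcircle:
  fixes A B C :: "real^2"
  assumes "\<not> collinear {A, B, C}"
  shows "circle_through A B C (circumcircle A B C)"
  unfolding circumcircle_def by (rule theI'[OF circle_through_ex1[OF assms]])

end

theory Submission
  imports Defs
begin

text \<open>
  Place the circumcentre \<open>Z\<close> at the origin, let \<open>s = r\<^sup>2\<close> be the squared circumradius and read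
  points as complex numbers, \<open>a\<close>, \<open>b\<close>, \<open>c\<close> for the vertices and \<open>p\<close> for \<open>P\<close>. Because
  \<open>b cnj b = c cnj c = s\<close>, the chord through \<open>b\<close> and \<open>c\<close> has direction \<open>c - b\<close> with
  \<open>cnj (c - b) = - s (c - b) / (b c)\<close>. Perpendicularity to the chord and incidence with it thus
  become linear equations for the foot of \<open>p\<close> and its conjugate, and the foot has the closed form
  \<open>(p + b + c - b c cnj p / s) / 2\<close> (\<open>foot_on_chord\<close>).

  Differences of two feet then factor, for example as \<open>(b - a) (s - c cnj p) / (2 s)\<close>. Together with
  the inscribed angle relation between the vertices this gives Euler's formula for the
  signed area of the pedal triangle \<open>D E F\<close> (\<open>pedal_triangle_area\<close>):
  \<open>4 r\<^sup>2 [D E F] = (r\<^sup>2 - |P - Z|\<^sup>2) [A B C]\<close>.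
  As \<open>[A B C]\<close> and \<open>r\<close> are nonzero, the feet are collinear exactly when \<open>|P - Z| = r\<close>.
  The formula holds for every \<open>P\<close>, so no case distinction arises when some of the feet coincide.
\<close>

definition complex_from :: "real^2 \<Rightarrow> real^2 \<Rightarrow> complex" where
  "complex_from Z X = Complex (X$1 - Z$1) (X$2 - Z$2)"

lemma complex_from_eq_iff: "complex_from Z X = complex_from Z Y \<longleftrightarrow> X = Y"
  by (auto simp: complex_from_def vec_eq_iff forall_2)

lemma dist_eq_cmod: "dist Z X = cmod (complex_from Z X)"
  by (simp add: dist_norm norm_eq_sqrt_inner inner_vec_def sum_2 complex_from_def inner_complex_def
      algebra_simps)

lemma mem_sphere_iff_complex_from:
  assumes "r \<ge> 0"
  shows "X \<in> sphere Z r \<longleftrightarrow>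
    complex_from Z X * cnj (complex_from Z X) = complex_of_real (r\<^sup>2)"
proof -
  have "X \<in> sphere Z r \<longleftrightarrow> (cmod (complex_from Z X))\<^sup>2 = r\<^sup>2"
    using assms by (simp add: dist_eq_cmod)
  then show ?thesis
    by (simp only: complex_norm_square[symmetric] of_real_eq_iff)
qed

definition signed_area2 :: "real^2 \<Rightarrow> real^2 \<Rightarrow> real^2 \<Rightarrow> real" where
  "signed_area2 X Y W = (Y$1 - X$1) * (W$2 - X$2) - (Y$2 - X$2) * (W$1 - X$1)"

lemma signed_area2_complex_from:
  "signed_area2 X Y W =
    Im (cnj (complex_from Z Y - complex_from Z X) * (complex_from Z W - complex_from Z X))"
  by (simp add: signed_area2_def complex_from_def algebra_simps)

lemma collinear_iff_signed_area2:
  "collinear {X, Y, W} \<longleftrightarrow> signed_area2 X Y W = 0"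
proof
  assume "collinear {X, Y, W}"
  then obtain u where u: "\<And>S T. S \<in> {X, Y, W} \<Longrightarrow> T \<in> {X, Y, W} \<Longrightarrow> \<exists>c. S - T = c *\<^sub>R u"
    unfolding collinear_def by blast
  obtain s t where "Y - X = s *\<^sub>R u" "W - X = t *\<^sub>R u"
    using u[of Y X] u[of W X] by auto
  then have "Y$i - X$i = s * u$i" "W$i - X$i = t * u$i" for i
    by (simp_all add: vec_eq_iff)
  then show "signed_area2 X Y W = 0" by (simp add: signed_area2_def)
next
  assume "signed_area2 X Y W = 0"
  then show "collinear {X, Y, W}"
    using noncollinear_det[of X Y W] unfolding signed_area2_def by blast
qed

text \<open>
  The two conditions defining the foot, each written as an equation between a complex number and
  its conjugate: perpendicularity says that \<open>(d - p) cnj (c - b)\<close> is purely imaginary, incidence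
  that \<open>(d - b) cnj (c - b)\<close> is real.
\<close>

lemma foot_equations:
  fixes B C P Z :: "real^2"
  assumes "B \<noteq> C"
  defines "D \<equiv> orth_proj (affine hull {B, C}) P"
  defines "b \<equiv> complex_from Z B" and "c \<equiv> complex_from Z C"
    and "p \<equiv> complex_from Z P" and "d \<equiv> complex_from Z D"
  shows "(d - p) * (cnj c - cnj b) + (cnj d - cnj p) * (c - b) = 0"
    and "(d - b) * (cnj c - cnj b) - (cnj d - cnj b) * (c - b) = 0"
proof -
  have D: "is_orth_proj (affine hull {B, C}) P D"
    unfolding D_def by (rule is_orth_proj_orth_proj[OF assms(1)])
  have "B \<in> affine hull {B, C}" "C \<in> affine hull {B, C}" by (simp_all add: hull_inc)
  then have "(P - D) \<bullet> (C - B) = 0"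
    using D by (simp add: is_orth_proj_def orthogonal_def)
  then show "(d - p) * (cnj c - cnj b) + (cnj d - cnj p) * (c - b) = 0"
    unfolding b_def c_def p_def d_def
    by (simp add: complex_eq_iff complex_from_def inner_vec_def sum_2 algebra_simps)
  from D have "collinear {B, C, D}"
    by (simp add: is_orth_proj_def affine_hull_3_imp_collinear)
  then have "signed_area2 B C D = 0" by (simp add: collinear_iff_signed_area2)
  then show "(d - b) * (cnj c - cnj b) - (cnj d - cnj b) * (c - b) = 0"
    unfolding b_def c_def d_def
    by (simp add: complex_eq_iff complex_from_def signed_area2_def algebra_simps)
qed

text \<open>
  On a circle centred at \<open>Z\<close> the factor \<open>cnj c - cnj b\<close> in the two equations is a multiple of
  \<open>c - b\<close>. After cancelling \<open>c - b\<close>, subtracting the equations eliminates \<open>cnj d\<close>.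
\<close>

lemma foot_on_chord:
  fixes B C P Z :: "real^2" and s :: complex
  assumes "B \<noteq> C"
  defines "D \<equiv> orth_proj (affine hull {B, C}) P"
  defines "b \<equiv> complex_from Z B" and "c \<equiv> complex_from Z C"
    and "p \<equiv> complex_from Z P" and "d \<equiv> complex_from Z D"
  assumes s: "b * cnj b = s" "c * cnj c = s"
  shows "2 * s * d = s * (p + b + c) - b * c * cnj p"
proof -
  note eqs = foot_equations[OF assms(1), where P = P and Z = Z,
      folded D_def, folded b_def c_def p_def d_def]
  have nz: "c - b \<noteq> 0"
    using assms(1) by (simp add: b_def c_def complex_from_eq_iff)
  have chord: "b * c * (cnj c - cnj b) = - s * (c - b)"
  proof -
    have "b * c * (cnj c - cnj b) = b * (c * cnj c) - c * (b * cnj b)"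
      by (simp add: algebra_simps)
    then show ?thesis unfolding s by (simp add: algebra_simps)
  qed
  have "(c - b) * (b * c * (cnj d - cnj p) - s * (d - p)) = 0"
    using eqs(1) chord by algebra
  with nz have 1: "b * c * (cnj d - cnj p) = s * (d - p)" by simp
  have "(c - b) * (b * c * (cnj d - cnj b) + s * (d - b)) = 0"
    using eqs(2) chord by algebra
  with nz have 2: "b * c * (cnj d - cnj b) + s * (d - b) = 0" by simp
  show ?thesis using 1 2 s by algebra
qed

text \<open>
  The number \<open>cnj (b - a) * (c - a)\<close> has the angle of the triangle at \<open>a\<close> as its argument. By the
  inscribed angle theorem twice this angle is the central angle from \<open>b\<close> to \<open>c\<close>, which is the
  argument of \<open>c * cnj b\<close>; the equation expresses this without division.
\<close>

lemma inscribed_angle: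
  fixes a b c :: complex
  assumes "b * cnj b = a * cnj a" "c * cnj c = a * cnj a"
  shows "(cnj b - cnj a) * (c - a) * cnj c = (b - a) * (cnj c - cnj a) * cnj b"
  using assms by algebra

text \<open>
  The numbers \<open>(b - a) (r\<^sup>2 - c cnj p)\<close> and \<open>(c - a) (r\<^sup>2 - b cnj p)\<close> are \<open>2 r\<^sup>2\<close> times the sides
  of the pedal triangle at the foot on the chord from \<open>b\<close> to \<open>c\<close>. With
  \<open>k = cnj (b - a) (c - a)\<close>, expand the product on the left in \<open>p\<close> and \<open>cnj p\<close>: by the inscribed
  angle relation the two linear terms are conjugate to each other, so their sum is real, and the
  coefficient of \<open>p cnj p\<close> is \<open>r\<^sup>2 cnj k\<close>, whose imaginary part is \<open>- r\<^sup>2 Im k\<close>.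
\<close>

lemma Im_pedal_sides:
  fixes a b c p :: complex and r :: real
  assumes "a * cnj a = of_real (r\<^sup>2)" "b * cnj b = of_real (r\<^sup>2)" "c * cnj c = of_real (r\<^sup>2)"
  shows "Im (cnj ((b - a) * (of_real (r\<^sup>2) - c * cnj p)) * ((c - a) * (of_real (r\<^sup>2) - b * cnj p)))
    = r\<^sup>2 * (r\<^sup>2 - (cmod p)\<^sup>2) * Im (cnj (b - a) * (c - a))"
proof -
  define s where "s = complex_of_real (r\<^sup>2)"
  have cnj_s: "cnj s = s" by (simp add: s_def)
  note circle = assms[folded s_def]
  define k where "k = cnj (b - a) * (c - a)"
  define m where "m = (s - cnj c * p) * (s - b * cnj p)"
  have angle: "k * cnj c = cnj k * cnj b"
    using inscribed_angle[of b a c] circle by (simp add: k_def mult_ac)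
  then have angle': "cnj k * c = k * b"
    by (metis complex_cnj_cnj complex_cnj_mult)
  have cnj_m: "cnj m = (s - c * cnj p) * (s - cnj b * p)"
    by (simp add: m_def cnj_s)
  have "k * m - cnj (k * m) = s * (s - p * cnj p) * (k - cnj k)"
    unfolding complex_cnj_mult[of k m] cnj_m unfolding m_def
    using angle angle' circle(2,3) by algebra
  also have "s * (s - p * cnj p) = of_real (r\<^sup>2 * (r\<^sup>2 - (cmod p)\<^sup>2))"
    by (simp add: s_def complex_norm_square[symmetric])
  finally have "Im (k * m) = r\<^sup>2 * (r\<^sup>2 - (cmod p)\<^sup>2) * Im k"
    unfolding complex_diff_cnj complex_eq_iff by simp
  then show ?thesis
    by (simp only: k_def m_def s_def complex_cnj_mult complex_cnj_diff complex_cnj_complex_of_real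
        complex_cnj_cnj mult_ac)
qed

text \<open>
  Euler's formula for the pedal triangle. In the difference of two feet the closed form of
  \<open>foot_on_chord\<close> factors: two sides share a vertex, and the side joining their other endpoints
  splits off. This reduces the formula to \<open>Im_pedal_sides\<close>.
\<close>

lemma pedal_triangle_area:
  fixes A B C P Z :: "real^2"
  assumes "A \<noteq> B" "B \<noteq> C" "A \<noteq> C"
    and r: "r > 0" and circle: "A \<in> sphere Z r" "B \<in> sphere Z r" "C \<in> sphere Z r"
  shows "4 * r\<^sup>2 * signed_area2 (orth_proj (affine hull {B, C}) P)
      (orth_proj (affine hull {A, C}) P) (orth_proj (affine hull {A, B}) P)
    = (r\<^sup>2 - (dist Z P)\<^sup>2) * signed_area2 A B C"
    (is "_ * signed_area2 ?D ?E ?F = _")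
proof -
  define a b c p d e f where abc: "a = complex_from Z A" "b = complex_from Z B"
    "c = complex_from Z C" "p = complex_from Z P"
    and feet: "d = complex_from Z ?D" "e = complex_from Z ?E" "f = complex_from Z ?F"
  define s where "s = complex_of_real (r\<^sup>2)"
  have s: "a * cnj a = s" "b * cnj b = s" "c * cnj c = s"
    unfolding abc s_def using circle r mem_sphere_iff_complex_from[of r _ Z]
    by (auto simp del: mem_sphere)
  have d: "2 * s * d = s * (p + b + c) - b * c * cnj p"
    and e: "2 * s * e = s * (p + a + c) - a * c * cnj p"
    and f: "2 * s * f = s * (p + a + b) - a * b * cnj p"
    using s assms(1-3) foot_on_chord unfolding abc feet by blast+
  define X where "X = (b - a) * (s - c * cnj p)"
  define Y where "Y = (c - a) * (s - b * cnj p)"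
  have "2 * s * (d - e) = X" "2 * s * (d - f) = Y"
    using d e f unfolding X_def Y_def by algebra+
  then have XY: "of_real (2 * r\<^sup>2) * (e - d) = - X" "of_real (2 * r\<^sup>2) * (f - d) = - Y"
    by (simp_all add: s_def algebra_simps)
  have Im_scale: "Im (of_real t * z) = t * Im z" for t z by simp
  have "of_real ((2 * r\<^sup>2)\<^sup>2) * (cnj (e - d) * (f - d))
      = cnj (of_real (2 * r\<^sup>2) * (e - d)) * (of_real (2 * r\<^sup>2) * (f - d))"
    by (simp only: complex_cnj_mult complex_cnj_complex_of_real power2_eq_square of_real_mult
        mult_ac)
  also have "\<dots> = cnj X * Y" unfolding XY by simp
  finally have "of_real ((2 * r\<^sup>2)\<^sup>2) * (cnj (e - d) * (f - d)) = cnj X * Y" .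
  then have "Im (of_real ((2 * r\<^sup>2)\<^sup>2) * (cnj (e - d) * (f - d))) = Im (cnj X * Y)"
    by simp
  then have "(2 * r\<^sup>2)\<^sup>2 * signed_area2 ?D ?E ?F = Im (cnj X * Y)"
    unfolding signed_area2_complex_from[where Z = Z] feet[symmetric] Im_scale .
  also have "\<dots> = r\<^sup>2 * (r\<^sup>2 - (cmod p)\<^sup>2) * Im (cnj (b - a) * (c - a))"
    using Im_pedal_sides[of a r b c p] s unfolding X_def Y_def s_def by simp
  also have "Im (cnj (b - a) * (c - a)) = signed_area2 A B C"
    by (simp only: signed_area2_complex_from[where Z = Z] abc)
  also have "cmod p = dist Z P"
    by (simp only: dist_eq_cmod abc)
  finally have "r\<^sup>2 * (4 * r\<^sup>2 * signed_area2 ?D ?E ?F)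
      = r\<^sup>2 * ((r\<^sup>2 - (dist Z P)\<^sup>2) * signed_area2 A B C)"
    by (simp add: power2_eq_square mult_ac)
  then show ?thesis using r by simp
qed

theorem corollary1p3:
  fixes A B C :: "real^2"
  assumes "\<not> collinear {A, B, C}"
  shows "{P. collinear {orth_proj (affine hull {B, C}) P,
                        orth_proj (affine hull {A, C}) P,
                        orth_proj (affine hull {A, B}) P}} = circumcircle A B C"
proof -
  obtain Z r where K: "circumcircle A B C = sphere Z r" and r: "r > 0"
    and circle: "A \<in> sphere Z r" "B \<in> sphere Z r" "C \<in> sphere Z r"
    using circle_through_circumcircle[OF assms] unfolding circle_through_def by metis
  have distinct: "A \<noteq> B" "B \<noteq> C" "A \<noteq> C"
    using assms by (auto simp: insert_commute)
  have area: "signed_area2 A B C \<noteq> 0"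
    using assms by (simp add: collinear_iff_signed_area2)
  have "collinear {orth_proj (affine hull {B, C}) P, orth_proj (affine hull {A, C}) P,
      orth_proj (affine hull {A, B}) P} \<longleftrightarrow> P \<in> sphere Z r" for P
  proof -
    have "collinear {orth_proj (affine hull {B, C}) P, orth_proj (affine hull {A, C}) P,
        orth_proj (affine hull {A, B}) P} \<longleftrightarrow> r\<^sup>2 - (dist Z P)\<^sup>2 = 0"
      using pedal_triangle_area[OF distinct r circle, of P] r area
      unfolding collinear_iff_signed_area2
      by (metis mult_eq_0_iff zero_neq_numeral less_irrefl zero_eq_power2)
    also have "\<dots> \<longleftrightarrow> P \<in> sphere Z r"
      using r by (auto simp: power2_eq_iff_nonneg)
    finally show ?thesis .
  qed
  then show ?thesis unfolding K by blast
qed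

end
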